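(* Let $K$ be an $n \times n$ real matrix. If $K$ is not clan-free, then for any partial transpose $\tilde{K}$ of $K$ we have $R_e[K] = R_e[\tilde{K}]$ (as functions on $\mathbb{R}_+^n$).
   Context: Here $\mathbb{R}_+ = [0,\infty)$. For a square matrix $M$, $\rho(M)$ denotes its spectral radius, i.e. the maximum modulus of its complex eigenvalues. For $\eta \in \mathbb{R}_+^n$, $\mathrm{Diag}(\eta)$ is the $n\times n$ diagonal matrix with diagonal entries given by $\eta$. The effective spectral radius function of an $n\times n$ matrix $K$ is $R_e[K](\eta) = \rho(K \cdot \mathrm{Diag}(\eta))$ for $\eta \in \mathbb{R}_+^n$. For non-empty $\alpha,\beta \subset \{1,\ldots,n\}$, $K[\alpha,\beta]$ is the submatrix of $K$ obtained by keeping the rows in $\alpha$ and the columns in $\beta$, and $\alpha^c$ is the complement of $\alpha$ in $\{1,\ldots,n\}$. A subset $\alpha$ of $\{1,\ldots,n\}$ is a clan for $K$ if $2 \leq \mathrm{Card}(\alpha) \leq n-2$ and the submatrices $K[\alpha,\alpha^c]$ and $K[\alpha^c,\alpha]$ both have rank at most $1$. The matrix $K$ is clan-free if there exists no clan for $K$. Partial transpose: suppose $\alpha = \{1,\ldots,m\}$ is a clan for $K$ (so $2 \leq m \leq n-2$). Then there exist (in general non-unique) real column vectors $v, w$ of size $m$ and $b, c$ of size $n-m$ such that, in block form, $$K = \begin{pmatrix} A & v b^\top \\ c w^\top & B \end{pmatrix}.$$ For any such choice of $v,w,b,c$, the matrix $$\tilde{K} = \begin{pmatrix} A^\top & w b^\top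 \\ c v^\top & B \end{pmatrix}$$ is called a partial transpose of $K$ (it is not unique in general). For a general clan $\alpha$, partial transposes are defined in the same way after a simultaneous relabelling of the rows and columns that sends $\alpha$ to $\{1,\ldots,m\}$ with $m = \mathrm{Card}(\alpha)$ (followed by the inverse relabelling). *)

theory Defs
  imports
    "Jordan_Normal_Form.Spectral_Radius"
    "Jordan_Normal_Form.DL_Rank"
    "Jordan_Normal_Form.DL_Submatrix"
    "HOL-Combinatorics.Permutations"
begin

(* Indices are 0-based throughout: {..<n} plays the role of {1, ..., n}. *)

definition nonneg_orthant :: "nat \<Rightarrow> real vec set" where
  "nonneg_orthant n = {\<eta> \<in> carrier_vec n. \<forall>i<n. 0 \<le> \<eta> $ i}"

definition effective_spectral_radius :: "real mat \<Rightarrow> real vec \<Rightarrow> real" where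
  "effective_spectral_radius K \<eta> =
     spectral_radius (map_mat complex_of_real (K * mat_diag (dim_vec \<eta>) (\<lambda>i. \<eta> $ i)))"

definition mat_rank :: "real mat \<Rightarrow> nat" where
  "mat_rank M = vec_space.rank (dim_row M) M"

definition clan :: "nat \<Rightarrow> real mat \<Rightarrow> nat set \<Rightarrow> bool" where
  "clan n K \<alpha> \<longleftrightarrow>
     \<alpha> \<subseteq> {..<n} \<and> 2 \<le> card \<alpha> \<and> card \<alpha> + 2 \<le> n \<and>
     mat_rank (submatrix K \<alpha> ({..<n} - \<alpha>)) \<le> 1 \<and>
     mat_rank (submatrix K ({..<n} - \<alpha>) \<alpha>) \<le> 1"

definition clan_free :: "nat \<Rightarrow> real mat \<Rightarrow> bool" where
  "clan_free n K \<longleftrightarrow> \<not> (\<exists>\<alpha>. clan n K \<alpha>)"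

definition outer_prod :: "real vec \<Rightarrow> real vec \<Rightarrow> real mat" where
  "outer_prod v b = mat (dim_vec v) (dim_vec b) (\<lambda>(i, j). v $ i * b $ j)"

(* The case where the clan consists of the first m indices. *)
definition leading_partial_transpose :: "nat \<Rightarrow> nat \<Rightarrow> real mat \<Rightarrow> real mat \<Rightarrow> bool" where
  "leading_partial_transpose n m K K' \<longleftrightarrow>
     (\<exists>A \<in> carrier_mat m m. \<exists>B \<in> carrier_mat (n - m) (n - m).
      \<exists>v \<in> carrier_vec m. \<exists>w \<in> carrier_vec m.
      \<exists>b \<in> carrier_vec (n - m). \<exists>c \<in> carrier_vec (n - m).
        K = four_block_mat A (outer_prod v b) (outer_prod c w) B \<and>
        K' = four_block_mat (transpose_mat A) (outer_prod w b) (outer_prod c v) B)"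

(* Simultaneous relabelling of rows and columns: the old index p i becomes the new index i,
   so if p maps {..<m} onto \<alpha>, the relabelling sends \<alpha> to {..<m}. *)
definition relabel :: "nat \<Rightarrow> (nat \<Rightarrow> nat) \<Rightarrow> 'a mat \<Rightarrow> 'a mat" where
  "relabel n p M = mat n n (\<lambda>(i, j). M $$ (p i, p j))"

(* K' is required to be n x n, so that for p permuting {..<n} it is recovered from
   relabel n p K' by the inverse relabelling. *)
definition partial_transpose :: "nat \<Rightarrow> real mat \<Rightarrow> real mat \<Rightarrow> bool" where
  "partial_transpose n K K' \<longleftrightarrow>
     K' \<in> carrier_mat n n \<and>
     (\<exists>\<alpha> p. clan n K \<alpha> \<and> p permutes {..<n} \<and> p ` {..<card \<alpha>} = \<alpha> \<and>
        leading_partial_transpose n (card \<alpha>) (relabel n p K) (relabel n p K'))"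

end

theory Submission
  imports Defs
begin

text \<open>
  The two matrices \<open>K Diag(\<eta>)\<close> and \<open>K' Diag(\<eta>)\<close> even have the same characteristic polynomial.
  Characteristic polynomials are unchanged by a simultaneous relabelling of rows and columns
  (\<open>char_poly_relabel\<close>), so the clan may be taken to consist of the leading indices. Let \<open>D\<close> and \<open>E\<close>
  be the parts of the diagonal matrix on the clan and on its complement, and put \<open>X = z - A D\<close>.
  The Schur complement of \<open>X\<close> in \<open>z - K Diag(\<eta>)\<close> is
  \<open>(z - B E) - s c (E b)\<^sup>T\<close> with the scalar \<open>s = w\<^sup>T D X\<^sup>-\<^sup>1 v\<close>.
  Because both off-diagonal blocks have rank at most one, the determinant of \<open>z - K Diag(\<eta>)\<close> depends
  on \<open>A\<close>, \<open>v\<close>, \<open>w\<close> only through \<open>det X\<close> and \<open>s\<close>.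

  Partial transposition replaces \<open>X\<close> by \<open>X' = z - A\<^sup>T D\<close> and exchanges \<open>v\<close> and \<open>w\<close>. The determinant
  is preserved since \<open>det (z - A\<^sup>T D) = det (z - D A\<^sup>T)\<close>
  (\<open>det_smult_one_minus_mult_commute\<close>) and \<open>z - D A\<^sup>T = X\<^sup>T\<close>. The scalar is preserved since it is its own
  transpose and \<open>X\<^sup>T D = D X'\<close>, which turns \<open>v\<^sup>T X\<^sup>-\<^sup>T D w\<close> into \<open>v\<^sup>T D X'\<^sup>-\<^sup>1 w\<close>
  (\<open>det_rank_one_off_diagonal_transpose\<close>). This settles all \<open>z\<close> for which \<open>X\<close> is invertible, that is,
  all but finitely many \<open>z\<close>, and two polynomials that agree at infinitely many points are equal.
  Real values of \<open>z\<close> suffice: the complex eigenvalues are the complex roots of the real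
  characteristic polynomial.
\<close>

section \<open>Determinants via Schur complements\<close>

text \<open>Block elimination: the matrix is the product of a lower block triangular matrix with diagonal
  blocks \<open>X, 1\<close> and an upper one with diagonal blocks \<open>1, Y - C N V\<close>.\<close>

lemma det_schur_complement:
  fixes X :: "'a :: idom mat"
  assumes X: "X \<in> carrier_mat m m" and N: "N \<in> carrier_mat m m" and XN: "X * N = 1\<^sub>m m"
    and V: "V \<in> carrier_mat m k" and C: "C \<in> carrier_mat k m" and Y: "Y \<in> carrier_mat k k"
  shows "det (four_block_mat X V C Y) = det X * det (Y - C * N * V)"
proof -
  let ?S = "Y - C * N * V"
  let ?L = "four_block_mat X (0\<^sub>m m k) C (1\<^sub>m k)"
  let ?U = "four_block_mat (1\<^sub>m m) (N * V) (0\<^sub>m k m) ?S"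
  have NV: "N * V \<in> carrier_mat m k" and S: "?S \<in> carrier_mat k k"
    using N V C Y by auto
  have "X * (N * V) = V"
    using assoc_mult_mat[OF X N V] XN V by simp
  moreover have "C * (N * V) + ?S = Y"
    unfolding assoc_mult_mat[OF C N V] using C N V Y by (intro eq_matI) auto
  ultimately have "?L * ?U = four_block_mat X V C Y"
    using X N V C Y NV S
    by (subst mult_four_block_mat[OF X zero_carrier_mat C one_carrier_mat
          one_carrier_mat NV zero_carrier_mat S]) simp
  moreover have "det (?L * ?U) = det ?L * det ?U"
    using X S by (intro det_mult[of _ "m + k"]) auto
  moreover have "det ?L = det X"
    using det_four_block_mat_upper_right_zero[OF X refl C one_carrier_mat] by simp
  moreover have "det ?U = det ?S"
    using det_four_block_mat_lower_left_zero[OF one_carrier_mat NV refl S] by simp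
  ultimately show ?thesis by simp
qed

text \<open>Both sides are the determinant of the block matrix with rows \<open>(1, A)\<close> and \<open>(D, z)\<close>: the left one
  because \<open>D\<close> commutes with the scalar matrix \<open>z\<close>, the right one as a Schur complement. No inverse
  of \<open>D\<close> enters, so zeros among the entries of \<open>\<eta>\<close> are harmless.\<close>

lemma det_smult_one_minus_mult_commute:
  fixes A :: "'a :: idom mat"
  assumes A: "A \<in> carrier_mat m m" and D: "D \<in> carrier_mat m m"
  shows "det (z \<cdot>\<^sub>m 1\<^sub>m m - A * D) = det (z \<cdot>\<^sub>m 1\<^sub>m m - D * A)"
proof -
  let ?M = "four_block_mat (1\<^sub>m m) A D (z \<cdot>\<^sub>m 1\<^sub>m m)"
  have z: "z \<cdot>\<^sub>m 1\<^sub>m m \<in> carrier_mat m m" by simp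
  have comm: "D * (z \<cdot>\<^sub>m 1\<^sub>m m) = (z \<cdot>\<^sub>m 1\<^sub>m m) * D"
    using D by (simp add: mult_smult_distrib[OF D one_carrier_mat] mult_smult_assoc_mat[OF one_carrier_mat D])
  have "det ?M = det (z \<cdot>\<^sub>m 1\<^sub>m m - A * D)"
    using det_four_block_mat[OF one_carrier_mat A D z comm] by simp
  moreover have "det ?M = det (z \<cdot>\<^sub>m 1\<^sub>m m - D * A)"
    using det_schur_complement[OF one_carrier_mat one_carrier_mat _ A D z] D by simp
  ultimately show ?thesis by simp
qed

section \<open>Partial transposition and the characteristic polynomial\<close>

text \<open>The heart of the matter. The vectors are row matrices, so that the scalar
  \<open>w D X\<^sup>-\<^sup>1 v\<^sup>T\<close> through which \<open>v\<close> and \<open>w\<close> enter the Schur complement is a \<open>1 \<times> 1\<close> matrix, equal to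
  its own transpose \<open>v X\<^sup>-\<^sup>T D w\<^sup>T\<close>. The relation \<open>X\<^sup>T D = D X'\<close> then exchanges the roles of \<open>X\<close> and
  \<open>X'\<close>. It holds for \<open>X = z - A D\<close> and \<open>X' = z - A\<^sup>T D\<close> with symmetric \<open>D\<close>, and it does not by
  itself give \<open>det X = det X'\<close> when \<open>D\<close> is singular.\<close>

lemma det_rank_one_off_diagonal_transpose:
  fixes X :: "'a :: field mat"
  assumes X: "X \<in> carrier_mat m m" and X': "X' \<in> carrier_mat m m" and Y: "Y \<in> carrier_mat k k"
    and D: "D \<in> carrier_mat m m"
    and v: "v \<in> carrier_mat 1 m" and w: "w \<in> carrier_mat 1 m"
    and b: "b \<in> carrier_mat 1 k" and c: "c \<in> carrier_mat k 1"
    and intertwine: "X\<^sup>T * D = D * X'" and det: "det X = det X'" and nonzero: "det X \<noteq> 0"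
    and symD: "D\<^sup>T = D"
  shows "det (four_block_mat X (v\<^sup>T * b) (c * (w * D)) Y)
       = det (four_block_mat X' (w\<^sup>T * b) (c * (v * D)) Y)"
proof -
  have inverse: "\<exists>N \<in> carrier_mat m m. Z * N = 1\<^sub>m m \<and> N * Z = 1\<^sub>m m"
    if "Z \<in> carrier_mat m m" "det Z \<noteq> 0" for Z :: "'a mat"
    using det_non_zero_imp_unit[OF that, of "()"] unfolding Units_def ring_mat_simps by auto
  obtain N where N: "N \<in> carrier_mat m m" and XN: "X * N = 1\<^sub>m m"
    using inverse[OF X nonzero] by blast
  obtain N' where N': "N' \<in> carrier_mat m m" and XN': "X' * N' = 1\<^sub>m m"
    using inverse[OF X'] nonzero det by metis
  have NX: "N\<^sup>T * X\<^sup>T = 1\<^sub>m m"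
    using transpose_mult[OF X N] XN by simp
  have "D * N' = N\<^sup>T * (X\<^sup>T * D) * N'"
    using assoc_mult_mat[of "N\<^sup>T" m m "X\<^sup>T" m D m] N X D NX by simp
  also have "\<dots> = N\<^sup>T * D * (X' * N')"
    unfolding intertwine using N D X' N'
    by (simp add: assoc_mult_mat[of _ m m _ m _ m])
  finally have DN: "D * N' = N\<^sup>T * D"
    unfolding XN' using N D by simp
  have scalar: "(w * D) * N * v\<^sup>T = (v * D) * N' * w\<^sup>T" (is "?s = ?s'")
  proof -
    have s: "?s \<in> carrier_mat 1 1" using w D N v by auto
    have symmetric: "S\<^sup>T = S" if "S \<in> carrier_mat 1 1" for S :: "'a mat"
      using that by (intro eq_matI) auto
    have "?s = ?s\<^sup>T"
      using symmetric[OF s] by simp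
    also have "\<dots> = v * (N\<^sup>T * (D * w\<^sup>T))"
      using w D N v symD
      by (simp add: transpose_mult[of _ 1 m _ 1] transpose_mult[of _ 1 m _ m]
          transpose_mult[of _ m m _ m] assoc_mult_mat[of _ m m _ m _ 1])
    also have "\<dots> = v * (N\<^sup>T * D) * w\<^sup>T"
      using w D N v by (simp add: assoc_mult_mat[of _ 1 m _ m _ 1] assoc_mult_mat[of _ m m _ m _ 1])
    also have "\<dots> = ?s'"
      unfolding DN[symmetric] using v D N' by (simp add: assoc_mult_mat[of _ 1 m _ m _ m])
    finally show ?thesis .
  qed
  have schur: "det (four_block_mat Z (x\<^sup>T * b) (c * (y * D)) Y)
      = det Z * det (Y - c * ((y * D) * M * x\<^sup>T) * b)"
    if "Z \<in> carrier_mat m m" "M \<in> carrier_mat m m" "Z * M = 1\<^sub>m m"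
      "x \<in> carrier_mat 1 m" "y \<in> carrier_mat 1 m" for Z M x y
  proof -
    have yD: "y * D \<in> carrier_mat 1 m" and xb: "x\<^sup>T * b \<in> carrier_mat m k"
      and xT: "x\<^sup>T \<in> carrier_mat m 1" and yDM: "y * D * M \<in> carrier_mat 1 m"
      and cy: "c * (y * D) \<in> carrier_mat k m"
      using that D b c by auto
    have "c * (y * D) * M * (x\<^sup>T * b) = c * ((y * D) * M * x\<^sup>T) * b"
      using assoc_mult_mat[OF c yD that(2)] assoc_mult_mat[OF c yDM xT]
        assoc_mult_mat[of "c * (y * D * M)" k m "x\<^sup>T" 1 b k] c yDM xT b by simp
    then show ?thesis
      using det_schur_complement[OF that(1-3) xb cy Y] by simp
  qed
  show ?thesis
    using schur[OF X N XN v w] schur[OF X' N' XN' w v] scalar det by simp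
qed

lemma poly_char_poly:
  fixes A :: "'a :: field mat"
  assumes A: "A \<in> carrier_mat n n"
  shows "poly (char_poly A) z = det (z \<cdot>\<^sub>m 1\<^sub>m n - A)"
proof -
  have "- char_matrix A z = z \<cdot>\<^sub>m 1\<^sub>m n - A"
    using A by (intro eq_matI) (auto simp: char_matrix_def)
  then show ?thesis using char_poly_matrix[OF A] by simp
qed

text \<open>The shape required by \<open>det_rank_one_off_diagonal_transpose\<close>: the diagonal entries belonging to
  the second block, and the signs, are absorbed into \<open>b\<close> and \<open>c\<close>, which partial transposition keeps,
  whereas those of the first block stay visible next to \<open>w\<close>.\<close>

lemma smult_one_minus_block_times_diag:
  fixes z :: "'a :: comm_ring_1"
  assumes A: "A \<in> carrier_mat m m" and B: "B \<in> carrier_mat k k"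
    and v: "v \<in> carrier_mat 1 m" and w: "w \<in> carrier_mat 1 m"
    and b: "b \<in> carrier_mat 1 k" and c: "c \<in> carrier_mat k 1"
  shows "z \<cdot>\<^sub>m 1\<^sub>m (m + k) - four_block_mat A (v\<^sup>T * b) (c * w) B * mat_diag (m + k) f
    = four_block_mat (z \<cdot>\<^sub>m 1\<^sub>m m - A * mat_diag m f)
        (v\<^sup>T * - (b * mat_diag k (\<lambda>j. f (m + j)))) (- c * (w * mat_diag m f))
        (z \<cdot>\<^sub>m 1\<^sub>m k - B * mat_diag k (\<lambda>j. f (m + j)))" (is "?l = ?r")
proof -
  have K: "four_block_mat A (v\<^sup>T * b) (c * w) B \<in> carrier_mat (m + k) (m + k)"
    using A B by simp
  note diag = mat_diag_mult_right[OF K] mat_diag_mult_right[OF A] mat_diag_mult_right[OF B]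
    mat_diag_mult_right[OF b] mat_diag_mult_right[OF w]
  show ?thesis
    unfolding diag using assms
    by (intro eq_matI) (auto simp: scalar_prod_def)
qed

lemma char_poly_rank_one_off_diagonal_transpose:
  fixes A :: "real mat"
  assumes A: "A \<in> carrier_mat m m" and B: "B \<in> carrier_mat k k"
    and v: "v \<in> carrier_mat 1 m" and w: "w \<in> carrier_mat 1 m"
    and b: "b \<in> carrier_mat 1 k" and c: "c \<in> carrier_mat k 1"
  shows "char_poly (four_block_mat A (v\<^sup>T * b) (c * w) B * mat_diag (m + k) f)
       = char_poly (four_block_mat A\<^sup>T (w\<^sup>T * b) (c * v) B * mat_diag (m + k) f)"
    (is "char_poly ?M = char_poly ?M'")
proof -
  let ?D = "mat_diag m f"
  have D: "?D \<in> carrier_mat m m" and symD: "?D\<^sup>T = ?D"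
    by (auto simp: mat_diag_def)
  have AD: "A * ?D \<in> carrier_mat m m" and AT: "A\<^sup>T \<in> carrier_mat m m" using A D by auto
  have M: "?M \<in> carrier_mat (m + k) (m + k)" "?M' \<in> carrier_mat (m + k) (m + k)"
    by (intro mult_carrier_mat[OF four_block_carrier_mat mat_diag_dim]; use A B in simp)+
  have agree: "poly (char_poly ?M) z = poly (char_poly ?M') z"
    if "poly (char_poly (A * ?D)) z \<noteq> 0" for z
  proof -
    let ?X = "z \<cdot>\<^sub>m 1\<^sub>m m - A * ?D" and ?X' = "z \<cdot>\<^sub>m 1\<^sub>m m - A\<^sup>T * ?D"
    have z: "z \<cdot>\<^sub>m 1\<^sub>m m \<in> carrier_mat m m" by simp
    have X: "?X \<in> carrier_mat m m" and X': "?X' \<in> carrier_mat m m"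
      by (intro minus_carrier_mat mult_carrier_mat[OF _ D] A AT)+
    have "?X\<^sup>T = z \<cdot>\<^sub>m 1\<^sub>m m - (A * ?D)\<^sup>T"
      using A carrier_matD[OF D] by (intro eq_matI) auto
    then have XT: "?X\<^sup>T = z \<cdot>\<^sub>m 1\<^sub>m m - ?D * A\<^sup>T"
      unfolding transpose_mult[OF A D] symD .
    have "?X\<^sup>T * ?D = z \<cdot>\<^sub>m ?D - ?D * A\<^sup>T * ?D"
      unfolding XT minus_mult_distrib_mat[OF z mult_carrier_mat[OF D AT] D]
        mult_smult_assoc_mat[OF one_carrier_mat D] left_mult_one_mat[OF D] ..
    also have "\<dots> = ?D * ?X'"
      unfolding mult_minus_distrib_mat[OF D z mult_carrier_mat[OF AT D]]
        assoc_mult_mat[OF D AT D] mult_smult_distrib[OF D one_carrier_mat]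
        right_mult_one_mat[OF D] ..
    finally have intertwine: "?X\<^sup>T * ?D = ?D * ?X'" .
    have "det ?X = det ?X\<^sup>T" using det_transpose[OF X] by simp
    also have "\<dots> = det ?X'"
      unfolding XT by (rule det_smult_one_minus_mult_commute[OF D AT])
    finally have det: "det ?X = det ?X'" .
    have nonzero: "det ?X \<noteq> 0" using that poly_char_poly[OF AD] by simp
    show ?thesis
      unfolding poly_char_poly[OF M(1)] poly_char_poly[OF M(2)]
        smult_one_minus_block_times_diag[OF A B v w b c]
        smult_one_minus_block_times_diag[OF AT B w v b c]
      by (rule det_rank_one_off_diagonal_transpose[OF X X' _ D v w _ _ intertwine det nonzero symD])
        (use B b c in \<open>auto simp: mat_diag_def\<close>)
  qed
  have "char_poly (A * ?D) \<noteq> 0"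
    using degree_monic_char_poly[OF AD] by auto
  then have "finite {z. poly (char_poly (A * ?D)) z = 0}" by (rule poly_roots_finite)
  then have "infinite (UNIV - {z. poly (char_poly (A * ?D)) z = 0})"
    using infinite_UNIV_char_0 by (rule Diff_infinite_finite)
  moreover have "UNIV - {z. poly (char_poly (A * ?D)) z = 0}
      \<subseteq> {z. poly (char_poly ?M - char_poly ?M') z = 0}"
    using agree by auto
  ultimately have "infinite {z. poly (char_poly ?M - char_poly ?M') z = 0}"
    using finite_subset by blast
  then have "char_poly ?M - char_poly ?M' = 0"
    using poly_roots_finite by blast
  then show ?thesis by simp
qed

section \<open>Relabelling and the spectral radius\<close>

text \<open>Permuting the rows and then the columns contributes the sign of \<open>p\<close> twice.\<close>

lemma det_relabel:
  fixes M :: "'a :: comm_ring_1 mat"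
  assumes M: "M \<in> carrier_mat n n" and p: "p permutes {..<n}"
  shows "det (relabel n p M) = det M"
proof -
  have p': "p permutes {0..<n}" using p by (simp add: lessThan_atLeast0)
  let ?R = "mat n n (\<lambda>(i, j). M $$ (p i, j))"
  have R: "?R\<^sup>T \<in> carrier_mat n n" by simp
  have lt: "p i < n" if "i < n" for i using permutes_in_image[OF p] that by simp
  have "relabel n p M = (mat n n (\<lambda>(i, j). ?R\<^sup>T $$ (p i, j)))\<^sup>T"
    using lt by (intro eq_matI) (auto simp: relabel_def)
  then have "det (relabel n p M) = det (mat n n (\<lambda>(i, j). ?R\<^sup>T $$ (p i, j)))"
    by (simp only: det_transpose[OF mat_carrier])
  also have "\<dots> = signof p * det ?R"
    unfolding det_permute_rows[OF R p'] by (simp only: det_transpose[OF mat_carrier])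
  also have "\<dots> = signof p * (signof p * det M)"
    unfolding det_permute_rows[OF M p'] ..
  finally have "det (relabel n p M) = signof p * (signof p * det M)" .
  then show ?thesis by (cases p rule: sign_cases) simp_all
qed

lemma char_poly_relabel:
  fixes M :: "'a :: comm_ring_1 mat"
  assumes M: "M \<in> carrier_mat n n" and p: "p permutes {..<n}"
  shows "char_poly (relabel n p M) = char_poly M"
proof -
  have lt: "p i < n" if "i < n" for i using permutes_in_image[OF p] that by simp
  have inj: "p i = p j \<longleftrightarrow> i = j" for i j using permutes_inj[OF p] by (simp add: inj_eq)
  have "char_poly_matrix (relabel n p M) = relabel n p (char_poly_matrix M)"
    using M lt inj by (intro eq_matI) (auto simp: relabel_def char_poly_matrix_def)
  then show ?thesis
    unfolding char_poly_def using det_relabel[OF char_poly_matrix_closed[OF M] p] by simp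
qed

lemma relabel_mult_diag:
  fixes M :: "'a :: comm_ring_1 mat"
  assumes M: "M \<in> carrier_mat n n" and p: "p permutes {..<n}"
  shows "relabel n p (M * mat_diag n f) = relabel n p M * mat_diag n (f \<circ> p)"
proof -
  have lt: "p i < n" if "i < n" for i using permutes_in_image[OF p] that by simp
  have R: "relabel n p M \<in> carrier_mat n n" by (simp add: relabel_def)
  show ?thesis
    unfolding mat_diag_mult_right[OF M] mat_diag_mult_right[OF R]
    using lt by (intro eq_matI) (auto simp: relabel_def)
qed

lemma effective_spectral_radius_cong_char_poly:
  assumes K: "K \<in> carrier_mat n n" and K': "K' \<in> carrier_mat n n" and \<eta>: "\<eta> \<in> carrier_vec n"
    and eq: "char_poly (K * mat_diag n (\<lambda>i. \<eta> $ i)) = char_poly (K' * mat_diag n (\<lambda>i. \<eta> $ i))"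
  shows "effective_spectral_radius K \<eta> = effective_spectral_radius K' \<eta>"
proof -
  have "spectrum (map_mat complex_of_real M) = {z. poly (map_poly of_real (char_poly M)) z = 0}"
    if "M \<in> carrier_mat n n" for M
    using spectrum_root_char_poly[of "map_mat complex_of_real M" n] that
      of_real_hom.char_poly_hom[OF that, where 'a = complex] by simp
  from this[of "K * _"] this[of "K' * _"] show ?thesis
    unfolding effective_spectral_radius_def spectral_radius_def
    using K K' \<eta> eq by simp
qed

lemma outer_prod_conv_mat_of_row:
  "outer_prod v b = (mat_of_row v)\<^sup>T * mat_of_row b"
  by (intro eq_matI) (auto simp: outer_prod_def mat_of_row_def scalar_prod_def)

theorem proposition10:
  fixes n :: nat and K :: "real mat"
  assumes "K \<in> carrier_mat n n"
    and "\<not> clan_free n K"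
  shows "\<forall>K'. partial_transpose n K K' \<longrightarrow>
           (\<forall>\<eta> \<in> nonneg_orthant n. effective_spectral_radius K \<eta> = effective_spectral_radius K' \<eta>)"
proof (intro allI impI ballI)
  fix K' \<eta>
  assume pt: "partial_transpose n K K'" and "\<eta> \<in> nonneg_orthant n"
  then have \<eta>: "\<eta> \<in> carrier_vec n" by (simp add: nonneg_orthant_def)
  from pt obtain \<alpha> p where K': "K' \<in> carrier_mat n n" and clan: "clan n K \<alpha>"
    and p: "p permutes {..<n}"
    and lead: "leading_partial_transpose n (card \<alpha>) (relabel n p K) (relabel n p K')"
    unfolding partial_transpose_def by blast
  let ?m = "card \<alpha>"
  from lead obtain A B v w b c
    where blocks: "A \<in> carrier_mat ?m ?m" "B \<in> carrier_mat (n - ?m) (n - ?m)"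
      "v \<in> carrier_vec ?m" "w \<in> carrier_vec ?m" "b \<in> carrier_vec (n - ?m)" "c \<in> carrier_vec (n - ?m)"
    and KB: "relabel n p K = four_block_mat A (outer_prod v b) (outer_prod c w) B"
    and KB': "relabel n p K' = four_block_mat A\<^sup>T (outer_prod w b) (outer_prod c v) B"
    unfolding leading_partial_transpose_def by blast
  let ?D = "mat_diag n (\<lambda>i. \<eta> $ i)"
  have n: "?m + (n - ?m) = n" using clan by (simp add: clan_def)
  have relabelled: "char_poly (L * ?D) = char_poly (relabel n p L * mat_diag n ((\<lambda>i. \<eta> $ i) \<circ> p))"
    if "L \<in> carrier_mat n n" for L :: "real mat"
    using char_poly_relabel[OF mult_carrier_mat[OF that mat_diag_dim] p]
    by (simp add: relabel_mult_diag[OF that p])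
  have "char_poly (K * ?D) = char_poly (K' * ?D)"
    unfolding relabelled[OF assms(1)] relabelled[OF K'] KB KB' outer_prod_conv_mat_of_row
    using blocks
    by (intro char_poly_rank_one_off_diagonal_transpose[where m = ?m and k = "n - ?m", unfolded n]) auto
  then show "effective_spectral_radius K \<eta> = effective_spectral_radius K' \<eta>"
    by (rule effective_spectral_radius_cong_char_poly[OF assms(1) K' \<eta>])
qed

end
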